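(* Let $f$ be the aZagreb topological index. A chemical graph $G$ minimizes $f$ over all chemical graphs of the same order and size as $G$ if and only if $G\in F_{10}$.
   Context: All graphs are finite, simple and undirected. A chemical graph is a connected graph of order (number of vertices) $n\ge 7$, size (number of edges) $m\le \frac{3n-3}{2}$ and maximum degree at most $3$. For such a graph, $x_{ij}$ ($i\le j$) denotes the number of $(i,j)$-edges, i.e. edges whose endpoints have degrees $i$ and $j$ (necessarily $x_{11}=0$). A degree-based topological index is a function of the form $f(G)=c_{12}x_{12}+c_{13}x_{13}+c_{22}x_{22}+c_{23}x_{23}+c_{33}x_{33}$ with real coefficients $c_{ij}$. The aZagreb (augmented Zagreb) index is the one with $c_{ij}=\left(\frac{ij}{i+j-2}\right)^3$. $F_{10}$ is the set of chemical graphs (of order $n$ and size $m$) with $(x_{12},x_{13},x_{22},x_{23},x_{33})$ equal to - $\left(0,\frac{6n-5m}{3},0,\frac{8m-6n}{3},0\right)$ if $n-1\le m\le\frac{6n-2}{5}$ and $m\bmod 3=0$; - $\left(0,\frac{6n-5m-1}{3},1,\frac{8m-6n-2}{3},0\right)$ if $n-1\le m\le\frac{6n-2}{5}$ and $m\bmod 3=1$; - $\left(0,\frac{6n-5m+1}{3},0,\frac{8m-6n-4}{3},1\right)$ if $n-1\le m\le\frac{6n-2}{5}$ and $m\bmod 3=2$; - $(0,0,1,m-1,0)$ if $m=\frac{6n-1}{5}$; - $(0,0,0,6n-4m,5m-6n)$ if $\frac{6n}{5}\le m\le\frac{3n-3}{2}$. *)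

theory Defs
  imports Complex_Main
begin

text \<open>A finite simple undirected graph is a pair of a finite vertex set and a set of edges,
  each edge being a two-element set of vertices.\<close>

type_synonym 'a ugraph = "'a set \<times> 'a set set"

abbreviation verts :: "'a ugraph \<Rightarrow> 'a set" where
  "verts G \<equiv> fst G"

abbreviation edges :: "'a ugraph \<Rightarrow> 'a set set" where
  "edges G \<equiv> snd G"

definition simple_graph :: "'a ugraph \<Rightarrow> bool" where
  "simple_graph G \<longleftrightarrow> finite (verts G) \<and> (\<forall>e\<in>edges G. e \<subseteq> verts G \<and> card e = 2)"

abbreviation graph_order :: "'a ugraph \<Rightarrow> nat" where
  "graph_order G \<equiv> card (verts G)"

abbreviation graph_size :: "'a ugraph \<Rightarrow> nat" where
  "graph_size G \<equiv> card (edges G)"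

definition degree :: "'a ugraph \<Rightarrow> 'a \<Rightarrow> nat" where
  "degree G v = card {e \<in> edges G. v \<in> e}"

definition connected_graph :: "'a ugraph \<Rightarrow> bool" where
  "connected_graph G \<longleftrightarrow>
     verts G \<noteq> {} \<and> (\<forall>u\<in>verts G. \<forall>v\<in>verts G. (u, v) \<in> {(x, y). {x, y} \<in> edges G}\<^sup>*)"

definition chemical_graph :: "'a ugraph \<Rightarrow> bool" where
  "chemical_graph G \<longleftrightarrow>
     simple_graph G \<and> connected_graph G \<and> graph_order G \<ge> 7 \<and>
     real (graph_size G) \<le> (3 * real (graph_order G) - 3) / 2 \<and>
     (\<forall>v\<in>verts G. degree G v \<le> 3)"

definition num_edges :: "nat \<Rightarrow> nat \<Rightarrow> 'a ugraph \<Rightarrow> nat" where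
  "num_edges i j G =
     card {e \<in> edges G. \<exists>u v. e = {u, v} \<and> degree G u = i \<and> degree G v = j}"

definition topological_index :: "(nat \<Rightarrow> nat \<Rightarrow> real) \<Rightarrow> 'a ugraph \<Rightarrow> real" where
  "topological_index c G =
     c 1 2 * real (num_edges 1 2 G) + c 1 3 * real (num_edges 1 3 G) +
     c 2 2 * real (num_edges 2 2 G) + c 2 3 * real (num_edges 2 3 G) +
     c 3 3 * real (num_edges 3 3 G)"

definition aZagreb :: "'a ugraph \<Rightarrow> real" where
  "aZagreb = topological_index
     (\<lambda>i j. ((real i * real j) / (real i + real j - 2)) ^ 3)"

text \<open>The competitors \<open>H\<close> have their vertices in the same type as \<open>G\<close>. This is no restriction:
  a graph of the same order as \<open>G\<close> over any other type is isomorphic to one on the vertex set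
  of \<open>G\<close>.\<close>

definition minimizes :: "('a ugraph \<Rightarrow> real) \<Rightarrow> 'a ugraph \<Rightarrow> bool" where
  "minimizes f G \<longleftrightarrow>
     (\<forall>H. chemical_graph H \<and> graph_order H = graph_order G \<and> graph_size H = graph_size G
        \<longrightarrow> f G \<le> f H)"

definition edge_type_vector :: "'a ugraph \<Rightarrow> real \<times> real \<times> real \<times> real \<times> real" where
  "edge_type_vector G =
     (real (num_edges 1 2 G), real (num_edges 1 3 G), real (num_edges 2 2 G),
      real (num_edges 2 3 G), real (num_edges 3 3 G))"

text \<open>All arithmetic in the range conditions and vector entries is over the reals, so there is
  no truncated subtraction or rounding division; only \<open>m mod 3\<close> is over the naturals.\<close>

definition F10 :: "'a ugraph set" where
  "F10 = {G. chemical_graph G \<and>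
     (let m' = graph_size G; n = real (graph_order G); m = real m'; x = edge_type_vector G in
        (n - 1 \<le> m \<and> m \<le> (6*n - 2) / 5 \<and> m' mod 3 = 0 \<and>
           x = (0, (6*n - 5*m) / 3, 0, (8*m - 6*n) / 3, 0)) \<or>
        (n - 1 \<le> m \<and> m \<le> (6*n - 2) / 5 \<and> m' mod 3 = 1 \<and>
           x = (0, (6*n - 5*m - 1) / 3, 1, (8*m - 6*n - 2) / 3, 0)) \<or>
        (n - 1 \<le> m \<and> m \<le> (6*n - 2) / 5 \<and> m' mod 3 = 2 \<and>
           x = (0, (6*n - 5*m + 1) / 3, 0, (8*m - 6*n - 4) / 3, 1)) \<or>
        (m = (6*n - 1) / 5 \<and>
           x = (0, 0, 1, m - 1, 0)) \<or>
        (6*n / 5 \<le> m \<and> m \<le> (3*n - 3) / 2 \<and>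
           x = (0, 0, 0, 6*n - 4*m, 5*m - 6*n)))}"

end

theory Submission
  imports Defs
begin

text \<open>Let a subcubic graph have order \<open>n\<close>, size \<open>m\<close> and \<open>x\<^sub>i\<^sub>j\<close> edges between vertices of degrees
  \<open>i\<close> and \<open>j\<close>. Counting the vertices of each degree through the incident edges gives, besides
  \<open>m = x\<^sub>1\<^sub>2 + x\<^sub>1\<^sub>3 + x\<^sub>2\<^sub>2 + x\<^sub>2\<^sub>3 + x\<^sub>3\<^sub>3\<close>, the identity \<open>6n - 5m = 4x\<^sub>1\<^sub>2 + 3x\<^sub>1\<^sub>3 + x\<^sub>2\<^sub>2 - x\<^sub>3\<^sub>3\<close>
  (\<open>subcubic_edge_count\<close>). The weights of the index are \<open>8\<close> for the types 12, 22 and 23, while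
  13 costs \<open>27/8\<close> and 33 costs \<open>729/64\<close>; hence the index is \<open>8m + (217x\<^sub>3\<^sub>3 - 296x\<^sub>1\<^sub>3)/64\<close>, to be
  minimized under the identity.

  Put \<open>D = 6n - 5m\<close>. Eliminating \<open>x\<^sub>1\<^sub>3\<close>, the excess of \<open>217x\<^sub>3\<^sub>3 - 296x\<^sub>1\<^sub>3\<close> over the
  constant \<open>-296D/3\<close> is
  \<open>(355x\<^sub>3\<^sub>3 + 296x\<^sub>2\<^sub>2 + 1184x\<^sub>1\<^sub>2)/3\<close>, and modulo 3 the identity reads
  \<open>m + x\<^sub>3\<^sub>3 = x\<^sub>1\<^sub>2 + x\<^sub>2\<^sub>2\<close>. So for \<open>D > 0\<close> the unique cheapest way to repair the residue of \<open>m\<close> is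
  to use nothing, one edge of type 22, or one edge of type 33. For \<open>D \<le> 0\<close> one eliminates
  \<open>x\<^sub>3\<^sub>3\<close> instead, and all of \<open>x\<^sub>1\<^sub>2\<close>, \<open>x\<^sub>1\<^sub>3\<close>, \<open>x\<^sub>2\<^sub>2\<close> have positive cost, so they vanish in the unique
  optimum. These optimal counts (\<open>extremal\<close>) are the vectors listed in \<open>F10\<close>.

  What remains is that for all admissible \<open>n\<close> and \<open>m\<close> the optimal counts are attained by a connected
  graph (\<open>extremal_existsI\<close>); otherwise a minimizer need not be in \<open>F10\<close>. The basic family consists of the
  graphs in which every edge has exactly one endpoint of degree 3. It is closed under joining
  one, two or three leaves to a new vertex of degree 3, and these moves, starting from the star
  with three leaves, reach every order that is possible for \<open>m\<close> divisible by 3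
  (\<open>alternating_existsI\<close>). A small local change at the end creates the single exceptional edge
  of type 22 or 33 needed for the other residues. For \<open>D \<le> 0\<close> one starts from the leafless member
  of order 5 and alternately links two vertices of degree 2, which creates an edge of type 33, and
  subdivides edges of type 33 (\<open>leafless_existsI\<close>).\<close>

section \<open>Counting edges by the degrees of their endpoints\<close>

definition edges_of_type :: "nat \<Rightarrow> nat \<Rightarrow> 'a ugraph \<Rightarrow> 'a set set" where
  "edges_of_type i j G = {e \<in> edges G. \<exists>u v. e = {u, v} \<and> degree G u = i \<and> degree G v = j}"

lemma num_edges_eq_card: "num_edges i j G = card (edges_of_type i j G)"
  by (simp add: num_edges_def edges_of_type_def)

lemma doubleton_in_edges_of_type_iff:
  "{u, v} \<in> edges_of_type i j G \<longleftrightarrow>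
     {u, v} \<in> edges G \<and>
     (degree G u = i \<and> degree G v = j \<or> degree G u = j \<and> degree G v = i)"
  by (auto simp: edges_of_type_def doubleton_eq_iff)

lemma finite_edges:
  assumes "simple_graph G"
  shows "finite (edges G)"
proof (rule finite_subset)
  show "edges G \<subseteq> Pow (verts G)" using assms by (auto simp: simple_graph_def)
  show "finite (Pow (verts G))" using assms by (simp add: simple_graph_def)
qed

lemma edgeE:
  assumes "simple_graph G" "e \<in> edges G"
  obtains u v where "e = {u, v}" "u \<noteq> v" "u \<in> verts G" "v \<in> verts G"
  using assms by (auto simp: simple_graph_def card_2_iff)

lemma edge_in_verts:
  assumes "simple_graph G" "{u, v} \<in> edges G"
  shows "u \<in> verts G" "v \<in> verts G" "u \<noteq> v"
  using assms by (auto simp: simple_graph_def card_2_iff doubleton_eq_iff)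

text \<open>Double counting of incidences, restricted to the vertices that satisfy \<open>P\<close>.\<close>
lemma sum_degree_eq_sum_edges:
  assumes "simple_graph G"
  shows "(\<Sum>v | v \<in> verts G \<and> P v. degree G v) = (\<Sum>e\<in>edges G. card {v \<in> e. P v})"
proof -
  let ?V = "{v \<in> verts G. P v}"
  have fin: "finite ?V" "finite (edges G)"
    using assms finite_edges[OF assms] by (auto simp: simple_graph_def)
  have "(\<Sum>v\<in>?V. degree G v) = (\<Sum>v\<in>?V. \<Sum>e\<in>edges G. of_bool (v \<in> e))"
    using fin by (simp add: degree_def Int_def)
  also have "\<dots> = (\<Sum>e\<in>edges G. \<Sum>v\<in>?V. of_bool (v \<in> e))"
    by (rule sum.swap)
  also have "\<dots> = (\<Sum>e\<in>edges G. card {v \<in> e. P v})"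
  proof (rule sum.cong)
    fix e assume "e \<in> edges G"
    hence "?V \<inter> {v. v \<in> e} = {v \<in> e. P v}"
      using assms by (auto simp: simple_graph_def)
    thus "(\<Sum>v\<in>?V. of_bool (v \<in> e)) = card {v \<in> e. P v}"
      using fin by simp
  qed simp
  finally show ?thesis .
qed

section \<open>Connected graphs\<close>

text \<open>A walk that starts inside a set and ends outside it has to cross the boundary.\<close>
lemma connected_graph_boundary_edge:
  assumes "connected_graph G" "x \<in> S" "x \<in> verts G" "y \<in> verts G" "y \<notin> S"
  obtains u v where "u \<in> S" "v \<notin> S" "{u, v} \<in> edges G"
proof -
  have "(x, y) \<in> {(x, y). {x, y} \<in> edges G}\<^sup>*"
    using assms by (auto simp: connected_graph_def)
  hence "y \<notin> S \<longrightarrow> (\<exists>u v. u \<in> S \<and> v \<notin> S \<and> {u, v} \<in> edges G)"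
    by (induction rule: rtrancl_induct) (use assms in auto)
  thus ?thesis using that assms(5) by blast
qed

text \<open>A set of vertices that grows one boundary edge at a time spans one edge fewer than it has
  vertices, until it is the whole vertex set.\<close>
lemma connected_graph_order_le_Suc_size:
  assumes "simple_graph G" "connected_graph G"
  shows "graph_order G \<le> graph_size G + 1"
proof -
  have finV: "finite (verts G)" and finE: "finite (edges G)"
    using assms(1) finite_edges[OF assms(1)] by (auto simp: simple_graph_def)
  have "\<exists>S F. S \<subseteq> verts G \<and> card S = Suc j \<and> F \<subseteq> edges G \<and> card F = j \<and> (\<forall>e\<in>F. e \<subseteq> S)"
    if "Suc j \<le> graph_order G" for j
    using that
  proof (induction j)
    case 0
    obtain r where "r \<in> verts G" using assms(2) by (auto simp: connected_graph_def)
    thus ?case by (intro exI[of _ "{r}"] exI[of _ "{}"]) auto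
  next
    case (Suc j)
    then obtain S F where SF: "S \<subseteq> verts G" "card S = Suc j" "F \<subseteq> edges G" "card F = j"
      "\<forall>e\<in>F. e \<subseteq> S" by auto
    have finS: "finite S" using SF(1) finV by (rule finite_subset)
    have finF: "finite F" using SF(3) finE by (rule finite_subset)
    have "\<not> verts G \<subseteq> S"
      using card_mono[OF finS, of "verts G"] SF(2) Suc.prems by auto
    then obtain y where y: "y \<in> verts G" "y \<notin> S" by auto
    obtain x where x: "x \<in> S" using SF(2) by fastforce
    obtain u v where uv: "u \<in> S" "v \<notin> S" "{u, v} \<in> edges G"
      using connected_graph_boundary_edge[OF assms(2) x _ y] x SF(1) by blast
    have "v \<in> verts G" using edge_in_verts[OF assms(1) uv(3)] by simp
    moreover have "{u, v} \<notin> F" using SF(5) uv(2) by auto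
    ultimately show ?case
      using SF uv finS finF
      by (intro exI[of _ "insert v S"] exI[of _ "insert {u, v} F"]) auto
  qed
  from this[of "graph_order G - 1"] obtain F where "F \<subseteq> edges G" "card F = graph_order G - 1"
    by (metis One_nat_def Suc_diff_1 Suc_leI assms(2) card_gt_0_iff connected_graph_def finV order_refl)
  thus ?thesis using card_mono[OF finE, of F] by linarith
qed

section \<open>Subcubic graphs and their edge counts\<close>

definition subcubic :: "'a ugraph \<Rightarrow> bool" where
  "subcubic G \<longleftrightarrow> simple_graph G \<and> connected_graph G \<and> graph_order G \<ge> 3 \<and>
     (\<forall>v\<in>verts G. degree G v \<le> 3)"

lemma subcubicD:
  assumes "subcubic G"
  shows "simple_graph G" "connected_graph G" "graph_order G \<ge> 3" "finite (verts G)"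
    "finite (edges G)" "v \<in> verts G \<Longrightarrow> degree G v \<le> 3"
  using assms finite_edges[of G] by (simp_all add: subcubic_def simple_graph_def)

lemma chemical_graph_iff_subcubic:
  "chemical_graph G \<longleftrightarrow> subcubic G \<and> graph_order G \<ge> 7 \<and> 2 * graph_size G + 3 \<le> 3 * graph_order G"
proof -
  have "real (graph_size G) \<le> (3 * real (graph_order G) - 3) / 2 \<longleftrightarrow>
    2 * graph_size G + 3 \<le> 3 * graph_order G"
    by (simp add: field_simps) linarith
  thus ?thesis by (auto simp: chemical_graph_def subcubic_def)
qed

text \<open>Since there are other vertices, some edge has to leave the singleton of \<open>v\<close>.\<close>
lemma subcubic_degree_pos:
  assumes "subcubic G" "v \<in> verts G"
  shows "degree G v \<ge> 1"
proof -
  note G = subcubicD[OF assms(1)]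
  have "\<not> verts G \<subseteq> {v}" using card_mono[of "{v}" "verts G"] G(3) by auto
  then obtain y where "y \<in> verts G" "y \<notin> {v}" by blast
  then obtain u w where "u \<in> {v}" "{u, w} \<in> edges G"
    using connected_graph_boundary_edge[OF G(2), of v "{v}" y] assms(2) by blast
  hence "{v, w} \<in> {e \<in> edges G. v \<in> e}" by auto
  thus ?thesis using G(5) by (auto simp: degree_def Suc_le_eq card_gt_0_iff)
qed

text \<open>An edge with two endpoints of degree one would be a whole component.\<close>
lemma subcubic_no_edge_between_leaves:
  assumes "subcubic G" "{u, v} \<in> edges G"
  shows "degree G u \<noteq> 1 \<or> degree G v \<noteq> 1"
proof -
  note G = subcubicD[OF assms(1)]
  note uv = edge_in_verts[OF G(1) assms(2)]
  have two: "degree G a \<noteq> 1" if "{a, b} \<in> edges G" "{a, c} \<in> edges G" "b \<noteq> c" for a b c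
  proof
    assume "degree G a = 1"
    moreover have "{a, b} \<in> {e \<in> edges G. a \<in> e}" "{a, c} \<in> {e \<in> edges G. a \<in> e}"
      using that by auto
    ultimately have "{a, b} = {a, c}" unfolding degree_def by (metis card_1_singletonE singletonD)
    thus False using that(3) by (auto simp: doubleton_eq_iff)
  qed
  have "card {u, v} < card (verts G)" using G(3) uv(3) by simp
  hence "\<not> verts G \<subseteq> {u, v}" using card_mono[of "{u, v}" "verts G"] by auto
  then obtain y where "y \<in> verts G" "y \<notin> {u, v}" by auto
  then obtain a w where "a \<in> {u, v}" "w \<notin> {u, v}" "{a, w} \<in> edges G"
    using connected_graph_boundary_edge[OF G(2), of u "{u, v}" y] uv by blast
  thus ?thesis using two[of u v w] two[of v u w] assms(2) by (auto simp: insert_commute)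
qed

lemma subcubic_edge_degrees:
  assumes "subcubic G" "{u, v} \<in> edges G"
  shows "(degree G u, degree G v) \<in> {(1,2),(2,1),(1,3),(3,1),(2,2),(2,3),(3,2),(3,3)}"
proof -
  note G = subcubicD[OF assms(1)]
  note uv = edge_in_verts[OF G(1) assms(2)]
  have "degree G u \<in> {1,2,3}" "degree G v \<in> {1,2,3}"
    using subcubic_degree_pos[OF assms(1)] G(6) uv by force+
  thus ?thesis using subcubic_no_edge_between_leaves[OF assms] by auto
qed

lemma num_edges_eq_sum:
  assumes "finite (edges G)"
  shows "num_edges i j G = (\<Sum>e\<in>edges G. of_bool (e \<in> edges_of_type i j G))"
proof -
  have "edges G \<inter> {e. e \<in> edges_of_type i j G} = edges_of_type i j G"
    by (auto simp: edges_of_type_def)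
  thus ?thesis using assms by (simp add: num_edges_eq_card)
qed

text \<open>With edges between two leaves excluded, five edge types remain. Applying
  \<open>sum_degree_eq_sum_edges\<close> to the vertices of degree \<open>i\<close> shows that \<open>i\<close> times their number is the number
  of edge ends of degree \<open>i\<close>; the last identity is the sum of these three, cleared of denominators.\<close>
lemma subcubic_edge_count:
  assumes "subcubic G"
  defines "x \<equiv> \<lambda>i j. num_edges i j G"
  shows "graph_size G = x 1 2 + x 1 3 + x 2 2 + x 2 3 + x 3 3"
    and "card {v \<in> verts G. degree G v = 1} = x 1 2 + x 1 3"
    and "2 * card {v \<in> verts G. degree G v = 2} = x 1 2 + 2 * x 2 2 + x 2 3"
    and "3 * card {v \<in> verts G. degree G v = 3} = x 1 3 + x 2 3 + 2 * x 3 3"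
    and "6 * graph_order G = 9 * x 1 2 + 8 * x 1 3 + 6 * x 2 2 + 5 * x 2 3 + 4 * x 3 3"
proof -
  note G = subcubicD[OF assms(1)]
  let ?T = "\<lambda>i j e. of_bool (e \<in> edges_of_type i j G) :: nat"
  let ?V = "\<lambda>i. {v \<in> verts G. degree G v = i}"
  have x: "x i j = (\<Sum>e\<in>edges G. ?T i j e)" for i j
    unfolding x_def by (rule num_edges_eq_sum[OF G(5)])
  have count: "i * card (?V i) = (\<Sum>e\<in>edges G. card {v \<in> e. degree G v = i})" for i
    using sum_degree_eq_sum_edges[OF G(1), of "\<lambda>v. degree G v = i"] by (simp add: mult.commute)
  have edge: "?T 1 2 e + ?T 1 3 e + ?T 2 2 e + ?T 2 3 e + ?T 3 3 e = 1 \<and>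
      card {v \<in> e. degree G v = 1} = ?T 1 2 e + ?T 1 3 e \<and>
      card {v \<in> e. degree G v = 2} = ?T 1 2 e + 2 * ?T 2 2 e + ?T 2 3 e \<and>
      card {v \<in> e. degree G v = 3} = ?T 1 3 e + ?T 2 3 e + 2 * ?T 3 3 e"
    if e: "e \<in> edges G" for e
  proof -
    obtain u v where uv: "e = {u, v}" "u \<noteq> v" using edgeE[OF G(1) e] by blast
    have card: "card {w \<in> {u, v}. degree G w = i} =
        of_bool (degree G u = i) + of_bool (degree G v = i)" for i
    proof -
      have "{w \<in> {u, v}. degree G w = i} =
        (if degree G u = i then {u} else {}) \<union> (if degree G v = i then {v} else {})" by auto
      thus ?thesis using uv(2) by simp
    qed
    show ?thesis
      using subcubic_edge_degrees[OF assms(1), of u v] e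
      unfolding uv(1) card doubleton_in_edges_of_type_iff by auto
  qed
  have "graph_size G = (\<Sum>e\<in>edges G. ?T 1 2 e + ?T 1 3 e + ?T 2 2 e + ?T 2 3 e + ?T 3 3 e)"
    using edge by simp
  thus m: "graph_size G = x 1 2 + x 1 3 + x 2 2 + x 2 3 + x 3 3"
    by (simp only: x sum.distrib)
  have "1 * card (?V 1) = (\<Sum>e\<in>edges G. ?T 1 2 e + ?T 1 3 e)"
    unfolding count by (rule sum.cong) (use edge in auto)
  thus n1: "card (?V 1) = x 1 2 + x 1 3"
    by (simp only: x sum.distrib mult_1)
  have "2 * card (?V 2) = (\<Sum>e\<in>edges G. ?T 1 2 e + 2 * ?T 2 2 e + ?T 2 3 e)"
    unfolding count by (rule sum.cong) (use edge in auto)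
  thus n2: "2 * card (?V 2) = x 1 2 + 2 * x 2 2 + x 2 3"
    by (simp only: x sum.distrib sum_distrib_left)
  have "3 * card (?V 3) = (\<Sum>e\<in>edges G. ?T 1 3 e + ?T 2 3 e + 2 * ?T 3 3 e)"
    unfolding count by (rule sum.cong) (use edge in auto)
  thus n3: "3 * card (?V 3) = x 1 3 + x 2 3 + 2 * x 3 3"
    by (simp only: x sum.distrib sum_distrib_left)
  have "verts G = ?V 1 \<union> ?V 2 \<union> ?V 3"
    using subcubic_degree_pos[OF assms(1)] G(6) by force
  hence "graph_order G = card (?V 1 \<union> ?V 2 \<union> ?V 3)" by simp
  also have "\<dots> = card (?V 1) + card (?V 2) + card (?V 3)"
    using G(4) by (subst card_Un_disjoint, simp, simp, fastforce)+ simp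
  finally show "6 * graph_order G = 9 * x 1 2 + 8 * x 1 3 + 6 * x 2 2 + 5 * x 2 3 + 4 * x 3 3"
    using n1 n2 n3 by linarith
qed

section \<open>The optimal edge counts\<close>

text \<open>The optimal edge counts in terms of the counts that carry a cost. The two that are left out,
  \<open>x\<^sub>1\<^sub>3\<close> and \<open>x\<^sub>2\<^sub>3\<close> or \<open>x\<^sub>2\<^sub>3\<close> and \<open>x\<^sub>3\<^sub>3\<close>, are then determined by the order and the size.\<close>
definition extremal :: "'a ugraph \<Rightarrow> bool" where
  "extremal G \<longleftrightarrow> num_edges 1 2 G = 0 \<and>
     (if 5 * graph_size G < 6 * graph_order G
      then num_edges 2 2 G = of_bool (graph_size G mod 3 = 1) \<and>
           num_edges 3 3 G = of_bool (graph_size G mod 3 = 2)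
      else num_edges 1 3 G = 0 \<and> num_edges 2 2 G = 0)"

text \<open>Relative to the weight \<open>8\<close>, an edge of type 33 costs \<open>217/64\<close> more and one of type 13 costs
  \<open>296/64\<close> less.\<close>
lemma aZagreb_eq:
  assumes "subcubic G"
  shows "64 * aZagreb G =
    512 * real (graph_size G) + 217 * real (num_edges 3 3 G) - 296 * real (num_edges 1 3 G)"
  using subcubic_edge_count(1)[OF assms]
  by (simp add: aZagreb_def topological_index_def power3_eq_cube field_simps)

lemma aZagreb_le_iff:
  assumes "subcubic G" "subcubic H" "graph_size H = graph_size G"
  shows "aZagreb G \<le> aZagreb H \<longleftrightarrow>
    217 * num_edges 3 3 G + 296 * num_edges 1 3 H \<le> 217 * num_edges 3 3 H + 296 * num_edges 1 3 G"
  using aZagreb_eq[OF assms(1)] aZagreb_eq[OF assms(2)] assms(3) by linarith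

text \<open>For edge counts \<open>a\<close>, \<open>b\<close>, \<open>c\<close>, \<open>e\<close> of the types 12, 13, 22, 33, the assumption is the identity for
  \<open>6n - 5m\<close>. The conclusion is the arithmetic obstruction that forces an exceptional edge when \<open>m\<close> is
  not divisible by 3.\<close>
lemma size_mod_3:
  fixes n m a b c e :: nat
  assumes "6 * n + e = 5 * m + 4 * a + 3 * b + c"
  shows "(m + e) mod 3 = (a + c) mod 3"
proof -
  have "(m + e) + 3 * (2 * n) = (a + c) + 3 * (2 * m + a + b)"
    using assms by simp
  thus ?thesis by (metis mod_mult_self2)
qed

text \<open>Both claims come from comparing the two instances of the identity for \<open>6n - 5m\<close>. The second
  one expresses that the optimal counts are unique.\<close>
lemma extremal_aZagreb_le:
  assumes "subcubic G" "subcubic H" "graph_order H = graph_order G" "graph_size H = graph_size G"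
    and "extremal H"
  shows "aZagreb H \<le> aZagreb G" and "aZagreb G \<le> aZagreb H \<Longrightarrow> extremal G"
proof -
  note g = subcubic_edge_count(1,5)[OF assms(1)]
  note h = subcubic_edge_count(1,5)[OF assms(2), unfolded assms(3,4)]
  define n m where nm: "n = graph_order G" "m = graph_size G"
  define a b c d e where x: "a = num_edges 1 2 G" "b = num_edges 1 3 G" "c = num_edges 2 2 G"
    "d = num_edges 2 3 G" "e = num_edges 3 3 G"
  define a' b' c' d' e' where y: "a' = num_edges 1 2 H" "b' = num_edges 1 3 H"
    "c' = num_edges 2 2 H" "d' = num_edges 2 3 H" "e' = num_edges 3 3 H"
  note g = g[folded nm x]
  note h = h[folded nm y]
  have G: "6 * n + e = 5 * m + 4 * a + 3 * b + c" using g by linarith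
  have H: "6 * n + e' = 5 * m + 4 * a' + 3 * b' + c'" using h by linarith
  have ext: "a' = 0 \<and> (if 5 * m < 6 * n then c' = of_bool (m mod 3 = 1) \<and> e' = of_bool (m mod 3 = 2)
      else b' = 0 \<and> c' = 0)"
    using assms(5)[unfolded extremal_def assms(3,4)] unfolding nm y .
  have *: "217 * e' + 296 * b \<le> 217 * e + 296 * b' \<and>
    (217 * e + 296 * b' \<le> 217 * e' + 296 * b \<longrightarrow>
      a = 0 \<and> (if 5 * m < 6 * n then c = of_bool (m mod 3 = 1) \<and> e = of_bool (m mod 3 = 2)
      else b = 0 \<and> c = 0))"
  proof (cases "5 * m < 6 * n")
    case False
    thus ?thesis using G H ext by auto
  next
    case D: True
    have vals: "a' = 0" "c' = of_bool (m mod 3 = 1)" "e' = of_bool (m mod 3 = 2)"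
      using ext D by auto
    have mod: "(m + e) mod 3 = (a + c) mod 3" using size_mod_3[OF G] .
    have "217 * e' + 296 * b \<le> 217 * e + 296 * b' \<and>
      (217 * e + 296 * b' \<le> 217 * e' + 296 * b \<longrightarrow> a = 0 \<and> c = c' \<and> e = e')"
    proof -
      consider "m mod 3 = 0" | "m mod 3 = 1" | "m mod 3 = 2" by linarith
      thus ?thesis
      proof cases
        case 1
        hence "c' = 0" "e' = 0" using vals by auto
        thus ?thesis using G H vals(1) by linarith
      next
        case 2
        \<comment> \<open>Some exceptional edge is needed, and a single edge of type 22 is the cheapest.\<close>
        hence "\<not> (a = 0 \<and> c = 0 \<and> e = 0)" using mod by auto
        moreover have "c' = 1" "e' = 0" using 2 vals by auto
        ultimately show ?thesis using G H vals(1) by linarith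
      next
        case 3
        \<comment> \<open>Only no exceptional edge and a single one of type 22 would be cheaper than a single one
          of type 33, and both have the wrong residue.\<close>
        hence "\<not> (a = 0 \<and> c = 0 \<and> e = 0)" "\<not> (a = 0 \<and> c = 1 \<and> e = 0)" using mod by auto
        moreover have "c' = 0" "e' = 1" using 3 vals by auto
        ultimately show ?thesis using G H vals(1) by linarith
      qed
    qed
    thus ?thesis using D vals by simp
  qed
  show "aZagreb H \<le> aZagreb G"
    using * unfolding aZagreb_le_iff[OF assms(2,1) assms(4)[symmetric]] x y by blast
  assume "aZagreb G \<le> aZagreb H"
  thus "extremal G"
    using * unfolding aZagreb_le_iff[OF assms(1,2,4)] extremal_def x y nm by blast
qed


section \<open>Three ways to enlarge a graph\<close>

text \<open>In each of the three operations every old edge can still be traversed, and every new vertex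
  has an old neighbour; this is all that connectedness needs.\<close>
lemma connected_graph_extend:
  assumes "connected_graph G" "verts G \<subseteq> verts G'"
    and old: "\<And>x y. {x, y} \<in> edges G \<Longrightarrow> (x, y) \<in> {(x, y). {x, y} \<in> edges G'}\<^sup>*"
    and new: "\<And>w. w \<in> verts G' - verts G \<Longrightarrow> \<exists>u\<in>verts G. (u, w) \<in> {(x, y). {x, y} \<in> edges G'}\<^sup>*"
  shows "connected_graph G'"
proof -
  let ?R = "{(x, y). {x, y} \<in> edges G}" and ?R' = "{(x, y). {x, y} \<in> edges G'}"
  have "sym ?R'" by (auto simp: sym_def insert_commute)
  hence sym: "(y, x) \<in> ?R'\<^sup>*" if "(x, y) \<in> ?R'\<^sup>*" for x y
    using that sym_rtrancl by (blast dest: symD)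
  have sub: "?R\<^sup>* \<subseteq> ?R'\<^sup>*"
    by (rule rtrancl_subset_rtrancl) (use old in auto)
  obtain r where r: "r \<in> verts G" using assms(1) by (auto simp: connected_graph_def)
  have V: "(r, v) \<in> ?R'\<^sup>*" if "v \<in> verts G" for v
    using assms(1) r that sub by (auto simp: connected_graph_def)
  have reach: "(r, v) \<in> ?R'\<^sup>*" if "v \<in> verts G'" for v
    using V new[of v] that by (cases "v \<in> verts G") (auto intro: rtrancl_trans)
  show ?thesis
    unfolding connected_graph_def
    using r assms(2) reach sym by (blast intro: rtrancl_trans)
qed

text \<open>The neighbours \<open>T\<close> of the new vertex \<open>w\<close> may be old or new; the new ones become leaves.\<close>
definition attach :: "'a \<Rightarrow> 'a set \<Rightarrow> 'a ugraph \<Rightarrow> 'a ugraph" where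
  "attach w T G = (insert w (verts G \<union> T), edges G \<union> (\<lambda>t. {w, t}) ` T)"

definition add_edge :: "'a \<Rightarrow> 'a \<Rightarrow> 'a ugraph \<Rightarrow> 'a ugraph" where
  "add_edge u v G = (verts G, insert {u, v} (edges G))"

definition subdivide :: "'a \<Rightarrow> 'a \<Rightarrow> 'a \<Rightarrow> 'a ugraph \<Rightarrow> 'a ugraph" where
  "subdivide u v w G =
     (insert w (verts G), insert {u, w} (insert {v, w} (edges G - {{u, v}})))"

lemma degree_eq_0:
  assumes "simple_graph G" "x \<notin> verts G"
  shows "degree G x = 0"
proof -
  have "{e \<in> edges G. x \<in> e} = {}" using assms by (auto simp: simple_graph_def)
  thus ?thesis by (simp only: degree_def card.empty)
qed

lemma simple_graph_no_edge:
  assumes "simple_graph G" "w \<notin> verts G"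
  shows "{w, t} \<notin> edges G" "{t, w} \<notin> edges G"
  using edge_in_verts[OF assms(1)] assms(2) by blast+

lemma attach_props:
  assumes G: "simple_graph G" "connected_graph G"
    and w: "w \<notin> verts G" "w \<notin> T" and T: "finite T" "T \<inter> verts G \<noteq> {}"
  shows "simple_graph (attach w T G)"
    and "connected_graph (attach w T G)"
    and "graph_order (attach w T G) = graph_order G + 1 + card (T - verts G)"
    and "graph_size (attach w T G) = graph_size G + card T"
    and "degree (attach w T G) x = (if x = w then card T else degree G x + of_bool (x \<in> T))"
proof -
  have fin: "finite (verts G)" "finite (edges G)"
    using G finite_edges[OF G(1)] by (auto simp: simple_graph_def)
  have disj: "edges G \<inter> (\<lambda>t. {w, t}) ` T = {}"
    using simple_graph_no_edge[OF G(1) w(1)] by auto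
  have inj: "inj_on (\<lambda>t. {w, t}) T" by (auto simp: inj_on_def doubleton_eq_iff)
  show "simple_graph (attach w T G)"
    using G fin T w by (auto simp: simple_graph_def attach_def card_2_iff)
  obtain s where s: "s \<in> T" "s \<in> verts G" using T by auto
  let ?R = "{(x, y). {x, y} \<in> edges (attach w T G)}"
  have sw: "(s, w) \<in> ?R" using s by (auto simp: attach_def insert_commute)
  show "connected_graph (attach w T G)"
  proof (rule connected_graph_extend[OF G(2)])
    fix v assume "v \<in> verts (attach w T G) - verts G"
    hence "v = w \<or> (w, v) \<in> ?R" by (auto simp: attach_def)
    hence "(s, v) \<in> ?R\<^sup>*" using sw by (meson converse_rtrancl_into_rtrancl r_into_rtrancl)
    thus "\<exists>u\<in>verts G. (u, v) \<in> ?R\<^sup>*" using s by blast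
  qed (auto simp: attach_def)
  have "card (verts G \<union> (T - verts G)) = graph_order G + card (T - verts G)"
    using T fin by (intro card_Un_disjoint) auto
  thus "graph_order (attach w T G) = graph_order G + 1 + card (T - verts G)"
    using w T fin by (simp add: attach_def)
  show "graph_size (attach w T G) = graph_size G + card T"
    using disj fin T inj by (simp add: attach_def card_Un_disjoint card_image)
  let ?N = "if x = w then (\<lambda>t. {w, t}) ` T else if x \<in> T then {{w, x}} else {}"
  have "{e \<in> edges (attach w T G). x \<in> e} = {e \<in> edges G. x \<in> e} \<union> ?N"
    by (auto simp: attach_def)
  moreover have "card ({e \<in> edges G. x \<in> e} \<union> ?N) = degree G x + card ?N"
    unfolding degree_def
  proof (rule card_Un_disjoint)
    have "?N \<subseteq> (\<lambda>t. {w, t}) ` T" by auto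
    thus "{e \<in> edges G. x \<in> e} \<inter> ?N = {}" using disj by blast
  qed (use fin T in auto)
  moreover have "card ?N = (if x = w then card T else of_bool (x \<in> T))"
    by (simp add: card_image[OF inj])
  ultimately show "degree (attach w T G) x = (if x = w then card T else degree G x + of_bool (x \<in> T))"
    using degree_eq_0[OF G(1) w(1)] by (simp add: degree_def[of "attach w T G"])
qed

lemma add_edge_props:
  assumes G: "simple_graph G" "connected_graph G"
    and uv: "u \<in> verts G" "v \<in> verts G" "u \<noteq> v" "{u, v} \<notin> edges G"
  shows "simple_graph (add_edge u v G)"
    and "connected_graph (add_edge u v G)"
    and "graph_order (add_edge u v G) = graph_order G"
    and "graph_size (add_edge u v G) = graph_size G + 1"
    and "degree (add_edge u v G) x = degree G x + of_bool (x = u \<or> x = v)"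
proof -
  have fin: "finite (edges G)" using finite_edges[OF G(1)] .
  show "simple_graph (add_edge u v G)"
    using G uv by (auto simp: simple_graph_def add_edge_def)
  show "connected_graph (add_edge u v G)"
    by (rule connected_graph_extend[OF G(2)]) (auto simp: add_edge_def)
  show "graph_order (add_edge u v G) = graph_order G"
    by (simp add: add_edge_def)
  show "graph_size (add_edge u v G) = graph_size G + 1"
    using fin uv by (simp add: add_edge_def)
  have "{e \<in> edges (add_edge u v G). x \<in> e} =
      (if x = u \<or> x = v then insert {u, v} {e \<in> edges G. x \<in> e} else {e \<in> edges G. x \<in> e})"
    by (auto simp: add_edge_def)
  thus "degree (add_edge u v G) x = degree G x + of_bool (x = u \<or> x = v)"
    using fin uv(4) by (simp add: degree_def)
qed

lemma subdivide_props:
  assumes G: "simple_graph G" "connected_graph G"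
    and uv: "{u, v} \<in> edges G" and w: "w \<notin> verts G"
  shows "simple_graph (subdivide u v w G)"
    and "connected_graph (subdivide u v w G)"
    and "graph_order (subdivide u v w G) = graph_order G + 1"
    and "graph_size (subdivide u v w G) = graph_size G + 1"
    and "degree (subdivide u v w G) x = (if x = w then 2 else degree G x)"
proof -
  have fin: "finite (verts G)" "finite (edges G)"
    using G finite_edges[OF G(1)] by (auto simp: simple_graph_def)
  note uv' = edge_in_verts[OF G(1) uv]
  have neq: "u \<noteq> w" "v \<noteq> w" using uv' w by auto
  note no = simple_graph_no_edge[OF G(1) w]
  show "simple_graph (subdivide u v w G)"
    using G fin uv' neq by (auto simp: simple_graph_def subdivide_def)
  let ?R = "{(x, y). {x, y} \<in> edges (subdivide u v w G)}"
  have new: "(u, w) \<in> ?R" "(w, v) \<in> ?R" "(v, w) \<in> ?R" "(w, u) \<in> ?R"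
    by (auto simp: subdivide_def insert_commute)
  show "connected_graph (subdivide u v w G)"
  proof (rule connected_graph_extend[OF G(2)])
    fix x y assume "{x, y} \<in> edges G"
    hence "(x, y) \<in> ?R \<or> x = u \<and> y = v \<or> x = v \<and> y = u"
      by (auto simp: subdivide_def doubleton_eq_iff)
    thus "(x, y) \<in> ?R\<^sup>*"
      using new by (meson r_into_rtrancl rtrancl_into_rtrancl)
  next
    fix x assume "x \<in> verts (subdivide u v w G) - verts G"
    hence "x = w" by (auto simp: subdivide_def)
    thus "\<exists>u\<in>verts G. (u, x) \<in> ?R\<^sup>*" using new uv' by blast
  qed (auto simp: subdivide_def)
  show "graph_order (subdivide u v w G) = graph_order G + 1"
    using fin w by (simp add: subdivide_def)
  have "card (edges G) > 0" using uv fin by (auto simp: card_gt_0_iff)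
  thus "graph_size (subdivide u v w G) = graph_size G + 1"
    using fin no uv uv' neq
    by (simp add: subdivide_def card_Diff_singleton doubleton_eq_iff)
  show "degree (subdivide u v w G) x = (if x = w then 2 else degree G x)"
  proof (cases "x = w \<or> x = u \<or> x = v")
    case False
    hence "{e \<in> edges (subdivide u v w G). x \<in> e} = {e \<in> edges G. x \<in> e}"
      by (auto simp: subdivide_def)
    thus ?thesis using False by (simp add: degree_def)
  next
    case True
    have *: "degree (subdivide u v w G) x = degree G x" if "x = u \<or> x = v"
    proof -
      let ?E = "{e \<in> edges G. x \<in> e}"
      have "{e \<in> edges (subdivide u v w G). x \<in> e} = insert {x, w} (?E - {{u, v}})"
        using that neq uv'(3) by (auto simp: subdivide_def)
      moreover have "{u, v} \<in> ?E" "finite ?E" using that uv fin by auto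
      moreover have "{x, w} \<notin> ?E" using no by auto
      ultimately show ?thesis
        unfolding degree_def using card_Suc_Diff1[of ?E "{u, v}"] by simp
    qed
    have "{e \<in> edges (subdivide u v w G). w \<in> e} = {{u, w}, {v, w}}"
      using neq no edgeE[OF G(1)] w G(1) by (auto simp: subdivide_def simple_graph_def)
    moreover have "{u, w} \<noteq> {v, w}" using uv'(3) by (auto simp: doubleton_eq_iff)
    ultimately have "degree (subdivide u v w G) w = 2" by (simp add: degree_def)
    thus ?thesis using True * neq by auto
  qed
qed

lemma fresh_vertex:
  assumes "simple_graph (G :: nat ugraph)"
  obtains w where "w \<notin> verts G"
  using assms ex_new_if_finite[of "verts G"] by (auto simp: simple_graph_def)

section \<open>Graphs in which every edge has exactly one endpoint of degree three\<close>

text \<open>Such a graph has no edges of the types 12, 22 and 33, which makes its counts optimal for \<open>m\<close>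
  divisible by 3.\<close>
definition alternating :: "'a ugraph \<Rightarrow> bool" where
  "alternating G \<longleftrightarrow> (\<forall>u v. {u, v} \<in> edges G \<longrightarrow> (degree G u = 3) \<noteq> (degree G v = 3))"

lemma num_edges_eq_0:
  assumes "\<And>u v. {u, v} \<in> edges G \<Longrightarrow> \<not> (degree G u = i \<and> degree G v = j)"
  shows "num_edges i j G = 0"
proof -
  have "edges_of_type i j G = {}" using assms by (auto simp: edges_of_type_def)
  thus ?thesis by (simp add: num_edges_eq_card)
qed

text \<open>In particular the number of leaves is \<open>(6n - 5m)/3\<close>, so that order and size alone tell whether
  there are enough leaves for the next step of a construction.\<close>
lemma alternating_counts:
  assumes "subcubic G" "alternating G"
  shows "num_edges 1 2 G = 0" "num_edges 2 2 G = 0" "num_edges 3 3 G = 0"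
    and "5 * graph_size G + 3 * card {v \<in> verts G. degree G v = 1} = 6 * graph_order G"
    and "3 * num_edges 2 3 G + 6 * graph_order G = 8 * graph_size G"
    and "graph_size G mod 3 = 0"
proof -
  show *: "num_edges 1 2 G = 0" "num_edges 2 2 G = 0" "num_edges 3 3 G = 0"
    by (rule num_edges_eq_0; use assms(2) in \<open>force simp: alternating_def\<close>)+
  show leaves: "5 * graph_size G + 3 * card {v \<in> verts G. degree G v = 1} = 6 * graph_order G"
    and "3 * num_edges 2 3 G + 6 * graph_order G = 8 * graph_size G"
    using subcubic_edge_count[OF assms(1)] * by linarith+
  show "graph_size G mod 3 = 0"
    using leaves
      size_mod_3[of "graph_order G" 0 "graph_size G" 0 "card {v \<in> verts G. degree G v = 1}" 0] by simp
qed

definition alternating_exists :: "nat \<Rightarrow> nat \<Rightarrow> bool" where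
  "alternating_exists n m \<longleftrightarrow> (\<exists>G :: nat ugraph.
     subcubic G \<and> alternating G \<and> graph_order G = n \<and> graph_size G = m)"

lemma alternating_exists_star: "alternating_exists 4 3"
proof -
  let ?G = "attach (0::nat) {1, 2, 3} ({1}, {})"
  have G0: "simple_graph ({1::nat}, {})" "connected_graph ({1::nat}, {})"
    by (auto simp: simple_graph_def connected_graph_def)
  note p = attach_props[OF G0, of 0 "{1, 2, 3}"]
  have deg: "degree ?G x = (if x = 0 then 3 else of_bool (x \<in> {1, 2, 3}))" for x
    by (subst p(5)) (auto simp: degree_def)
  have "{1, 2, 3} - {1} = {2, 3::nat}" by auto
  hence n: "graph_order ?G = 4" by (subst p(3)) auto
  have m: "graph_size ?G = 3" by (subst p(4)) auto
  have "subcubic ?G"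
    unfolding subcubic_def using p(1,2) n deg by auto
  moreover have "alternating ?G"
    unfolding alternating_def deg by (auto simp: attach_def doubleton_eq_iff)
  ultimately show ?thesis unfolding alternating_exists_def using n m by blast
qed

text \<open>A new vertex is joined to \<open>j\<close> old leaves and to \<open>3 - j\<close> new ones. The old leaves turn into
  vertices of degree 2 between two vertices of degree 3, so the graph stays alternating. This works
  for any choice of \<open>j\<close> leaves, even with a common neighbour: every new edge ends in the new vertex,
  so that no edge is doubled.\<close>
lemma alternating_exists_join_leaves:
  assumes "alternating_exists n m" "1 \<le> j" "j \<le> 3" "5 * m + 3 * j \<le> 6 * n"
  shows "alternating_exists (n + 4 - j) (m + 3)"
proof -
  obtain G :: "nat ugraph" where G: "subcubic G" "alternating G" "graph_order G = n" "graph_size G = m"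
    using assms(1) by (auto simp: alternating_exists_def)
  note g = subcubicD[OF G(1)]
  have "j \<le> card {v \<in> verts G. degree G v = 1}"
    using alternating_counts(4)[OF G(1,2)] G(3,4) assms(4) by linarith
  then obtain S where S: "S \<subseteq> {v \<in> verts G. degree G v = 1}" "card S = j" "finite S"
    by (meson obtain_subset_with_card_n)
  obtain w where w: "w \<notin> verts G" using fresh_vertex[OF g(1)] .
  have "infinite (- insert w (verts G))" using g(4) by simp
  then obtain P where P: "P \<subseteq> - insert w (verts G)" "card P = 3 - j" "finite P"
    using infinite_arbitrarily_large by metis
  let ?T = "S \<union> P" and ?G = "attach w (S \<union> P) G"
  have cT: "card ?T = 3"
    using S P assms(3) by (subst card_Un_disjoint) auto
  have "?T - verts G = P" using S P by auto
  hence cP: "card (?T - verts G) = 3 - j" using P by simp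
  have "S \<noteq> {}" using S(2) assms(2) by auto
  hence T: "w \<notin> ?T" "finite ?T" "?T \<inter> verts G \<noteq> {}" using S P w by auto
  note p = attach_props[OF g(1,2) w T]
  have deg3: "degree ?G x = 3 \<longleftrightarrow> degree G x = 3" and deg_le: "degree ?G x \<le> 3"
    if "x \<in> verts G" for x
    unfolding p(5) using that S(1) P(1) w g(6)[OF that] by auto
  have degT: "degree ?G x < 3" if "x \<in> ?T" for x
    unfolding p(5) using that S(1) P(1) w T(1) degree_eq_0[OF g(1), of x] by auto
  have degw: "degree ?G w = 3" unfolding p(5) by (simp add: cT)
  have n: "graph_order ?G = n + 4 - j" using p(3) cP G(3) assms(3) by simp
  have "subcubic ?G"
    unfolding subcubic_def
  proof (intro conjI ballI)
    fix x assume "x \<in> verts ?G"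
    hence "x = w \<or> x \<in> ?T \<or> x \<in> verts G" by (auto simp: attach_def)
    thus "degree ?G x \<le> 3" using deg_le degT degw by (auto simp: less_imp_le)
  qed (use p n g(3) G(3) assms(3) in auto)
  moreover have "alternating ?G"
    unfolding alternating_def
  proof (intro allI impI)
    fix x y assume "{x, y} \<in> edges ?G"
    then consider "{x, y} \<in> edges G" | "x = w" "y \<in> ?T" | "y = w" "x \<in> ?T"
      by (auto simp: attach_def doubleton_eq_iff)
    thus "(degree ?G x = 3) \<noteq> (degree ?G y = 3)"
    proof cases
      case 1
      thus ?thesis
        using deg3 edge_in_verts[OF g(1) 1] G(2) by (simp add: alternating_def)
    qed (use degT degw in force)+
  qed
  ultimately show ?thesis
    unfolding alternating_exists_def using n p(4) cT G(4) by (intro exI[of _ ?G]) simp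
qed

text \<open>Here \<open>k\<close> is the number of vertices of degree 3, and \<open>2n - 5k\<close> is the number of leaves. Joining
  one, two or three leaves to a new vertex changes the latter by \<open>1\<close>, \<open>-1\<close>, \<open>-3\<close>. At least two leaves
  are reached by the first move, one leaf is reached from two by the second, and none from three
  by the third.\<close>
lemma alternating_existsI:
  assumes "2 \<le> k" "n \<le> 3 * k + 1" "5 * k \<le> 2 * n"
  shows "alternating_exists n (3 * k)"
  using assms
proof (induction k arbitrary: n rule: dec_induct)
  case base
  hence "n = 7 \<or> n = 6 \<or> n = 5" by auto
  thus ?case
    using alternating_exists_join_leaves[OF alternating_exists_star, of 1]
      alternating_exists_join_leaves[OF alternating_exists_star, of 2]
      alternating_exists_join_leaves[OF alternating_exists_star, of 3] by auto
next
  case (step k)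
  consider "5 * k + 7 \<le> 2 * n" | "2 * n = 5 * k + 6" | "2 * n = 5 * k + 5"
    using step.prems by fastforce
  thus ?case
  proof cases
    case 1
    hence "alternating_exists (n - 3) (3 * k)" using step by auto
    from alternating_exists_join_leaves[OF this, of 1] show ?thesis
      using 1 by (simp add: algebra_simps)
  next
    case 2
    hence "alternating_exists (n - 2) (3 * k)" using step by auto
    from alternating_exists_join_leaves[OF this, of 2] show ?thesis
      using 2 by (simp add: algebra_simps)
  next
    case 3
    hence "alternating_exists (n - 1) (3 * k)" using step by auto
    from alternating_exists_join_leaves[OF this, of 3] show ?thesis
      using 3 by (simp add: algebra_simps)
  qed
qed


section \<open>Graphs realizing the optimal edge counts\<close>

definition extremal_exists :: "nat \<Rightarrow> nat \<Rightarrow> bool" where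
  "extremal_exists n m \<longleftrightarrow> (\<exists>G :: nat ugraph.
     subcubic G \<and> extremal G \<and> graph_order G = n \<and> graph_size G = m)"

lemma extremal_exists_if_alternating:
  assumes "alternating_exists n m"
  shows "extremal_exists n m"
proof -
  obtain G :: "nat ugraph" where G: "subcubic G" "alternating G" "graph_order G = n" "graph_size G = m"
    using assms by (auto simp: alternating_exists_def)
  note c = alternating_counts[OF G(1,2)]
  have "m mod 3 = 0" using c(6) G(4) by simp
  moreover have "num_edges 1 3 G = 0" if "\<not> 5 * m < 6 * n"
    using that c(4) G(3,4) subcubic_edge_count(2)[OF G(1)] by simp
  ultimately have "extremal G" using c G(3,4) by (auto simp: extremal_def)
  thus ?thesis unfolding extremal_exists_def using G by blast
qed

text \<open>Subdividing an edge of type 23 replaces it by one of type 22 and one of type 23. The second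
  assumption says that there is such an edge.\<close>
lemma extremal_exists_subdivide:
  assumes "alternating_exists n m" "6 * n < 8 * m"
  shows "extremal_exists (n + 1) (m + 1)"
proof -
  obtain G :: "nat ugraph" where G: "subcubic G" "alternating G" "graph_order G = n" "graph_size G = m"
    using assms(1) by (auto simp: alternating_exists_def)
  note g = subcubicD[OF G(1)]
  note c = alternating_counts[OF G(1,2)]
  have "num_edges 2 3 G \<noteq> 0" using c(5) assms(2) G(3,4) by simp
  hence "edges_of_type 2 3 G \<noteq> {}" by (auto simp: num_edges_eq_card)
  then obtain u v where uv: "{u, v} \<in> edges G" "degree G u = 2" "degree G v = 3"
    by (auto simp: edges_of_type_def)
  note uv' = edge_in_verts[OF g(1) uv(1)]
  obtain w where w: "w \<notin> verts G" using fresh_vertex[OF g(1)] .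
  let ?G = "subdivide u v w G"
  note p = subdivide_props[OF g(1,2) uv(1) w]
  have degw: "degree ?G w = 2" and deg: "x \<noteq> w \<Longrightarrow> degree ?G x = degree G x" for x
    by (simp_all add: p(5))
  have degu: "degree ?G u = 2" and degv: "degree ?G v = 3"
    using deg uv uv' w by metis+
  have edge: "{x, y} = {u, w} \<or> (degree ?G x = 3) \<noteq> (degree ?G y = 3)"
    if "{x, y} \<in> edges ?G" for x y
  proof -
    consider "{x, y} = {u, w}" | "{x, y} = {v, w}" | "{x, y} \<in> edges G"
      using \<open>{x, y} \<in> edges ?G\<close> by (auto simp: subdivide_def)
    thus ?thesis
    proof cases
      case 2
      thus ?thesis using degw degv by (auto simp: doubleton_eq_iff)
    next
      case 3
      hence "x \<noteq> w" "y \<noteq> w" using simple_graph_no_edge[OF g(1) w] by auto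
      thus ?thesis using deg 3 G(2) by (simp add: alternating_def)
    qed simp
  qed
  have "subcubic ?G"
    unfolding subcubic_def using p g(3,6) by (auto simp: subdivide_def)
  moreover have "num_edges 1 2 ?G = 0"
  proof (rule num_edges_eq_0)
    fix x y assume "{x, y} \<in> edges ?G"
    thus "\<not> (degree ?G x = 1 \<and> degree ?G y = 2)"
      using edge[of x y] degu degw by (auto simp: doubleton_eq_iff)
  qed
  moreover have "num_edges 3 3 ?G = 0"
  proof (rule num_edges_eq_0)
    fix x y assume "{x, y} \<in> edges ?G"
    thus "\<not> (degree ?G x = 3 \<and> degree ?G y = 3)"
      using edge[of x y] degu degw by (auto simp: doubleton_eq_iff)
  qed
  moreover have "edges_of_type 2 2 ?G = {{u, w}}"
  proof -
    have "{u, w} \<in> edges_of_type 2 2 ?G"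
      using degu degw unfolding doubleton_in_edges_of_type_iff by (simp add: subdivide_def)
    moreover have "e = {u, w}" if e: "e \<in> edges_of_type 2 2 ?G" for e
    proof -
      obtain x y where "e = {x, y}" "e \<in> edges ?G" "degree ?G x = 2" "degree ?G y = 2"
        using e by (auto simp: edges_of_type_def)
      thus ?thesis using edge[of x y] by simp
    qed
    ultimately show ?thesis by blast
  qed
  hence "num_edges 2 2 ?G = 1" by (simp add: num_edges_eq_card)
  moreover have "(m + 1) mod 3 = 1" using c(6) G(4) by presburger
  moreover have "5 * m \<le> 6 * n" using c(4) G(3,4) by (metis le_add1)
  ultimately have "subcubic ?G \<and> extremal ?G" using p(3,4) G(3,4) by (simp add: extremal_def)
  thus ?thesis unfolding extremal_exists_def using p(3,4) G(3,4) by (intro exI[of _ ?G]) simp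
qed

text \<open>When a leaf \<open>u\<close> is turned into a vertex of degree 3 and no other degree passes to or from 3, the
  single edge that was incident with \<open>u\<close> becomes the only edge of type 33.\<close>
lemma num_edges_if_leaf_becomes_cubic:
  assumes G: "subcubic G" "alternating G" and u: "u \<in> verts G" "degree G u = 1"
    and sub: "edges G \<subseteq> edges G'"
    and new: "\<And>e. e \<in> edges G' - edges G \<Longrightarrow> \<exists>y. e = {u, y} \<and> degree G' y < 3"
    and deg: "\<And>x. x \<in> verts G \<Longrightarrow> degree G' x = 3 \<longleftrightarrow> degree G x = 3 \<or> x = u"
  shows "num_edges 1 2 G' = 0" "num_edges 2 2 G' = 0" "num_edges 3 3 G' = 1"
proof -
  note g = subcubicD[OF G(1)]
  have edge: "{x, y} \<in> edges G' \<Longrightarrow> degree G' x = 3 \<or> degree G' y = 3" for x y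
  proof (cases "{x, y} \<in> edges G")
    case True
    thus ?thesis
      using G(2) deg edge_in_verts[OF g(1) True] by (auto simp: alternating_def)
  next
    case False
    assume "{x, y} \<in> edges G'"
    hence "x = u \<or> y = u" using new[of "{x, y}"] False by (auto simp: doubleton_eq_iff)
    thus ?thesis using deg[OF u(1)] by auto
  qed
  show "num_edges 1 2 G' = 0" "num_edges 2 2 G' = 0"
    using edge by (intro num_edges_eq_0; force)+
  have "e \<in> edges_of_type 3 3 G' \<longleftrightarrow> e \<in> {e \<in> edges G. u \<in> e}" for e
  proof (cases "e \<in> edges G")
    case True
    then obtain x y where xy: "e = {x, y}" using edgeE[OF g(1)] by blast
    note v = edge_in_verts[OF g(1) True[unfolded xy]]
    have "(degree G x = 3) \<noteq> (degree G y = 3)"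
      using G(2) True xy by (auto simp: alternating_def)
    thus ?thesis
      using True sub deg v u(2) unfolding xy doubleton_in_edges_of_type_iff by auto
  next
    case False
    have "e \<notin> edges_of_type 3 3 G'"
    proof
      assume "e \<in> edges_of_type 3 3 G'"
      then obtain y z where "e \<in> edges G'" "e = {y, z}" "degree G' y = 3" "degree G' z = 3"
        by (auto simp: edges_of_type_def)
      thus False using new[of e] False by (auto simp: doubleton_eq_iff)
    qed
    thus ?thesis using False by simp
  qed
  hence "edges_of_type 3 3 G' = {e \<in> edges G. u \<in> e}" by blast
  thus "num_edges 3 3 G' = 1" using u(2) by (simp add: num_edges_eq_card degree_def)
qed

text \<open>A leaf receives two new leaves as neighbours.\<close>
lemma extremal_exists_leaf_to_claw:
  assumes "alternating_exists n m" "5 * m + 3 \<le> 6 * n"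
  shows "extremal_exists (n + 2) (m + 2)"
proof -
  obtain G :: "nat ugraph" where G: "subcubic G" "alternating G" "graph_order G = n" "graph_size G = m"
    using assms(1) by (auto simp: alternating_exists_def)
  note g = subcubicD[OF G(1)]
  note c = alternating_counts[OF G(1,2)]
  have "card {v \<in> verts G. degree G v = 1} \<noteq> 0" using c(4) assms(2) G(3,4) by simp
  hence "{v \<in> verts G. degree G v = 1} \<noteq> {}" by (metis card.empty)
  then obtain u where u: "u \<in> verts G" "degree G u = 1" by blast
  obtain p where p: "p \<notin> verts G" using fresh_vertex[OF g(1)] .
  let ?H = "attach p {u} G"
  have up: "p \<notin> {u}" "finite {u}" "{u} \<inter> verts G \<noteq> {}" using u p by auto
  note h = attach_props[OF g(1,2) p up]
  obtain q where q: "q \<notin> verts ?H" using fresh_vertex[OF h(1)] .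
  hence q': "q \<notin> verts G" "q \<noteq> p" "q \<noteq> u" by (auto simp: attach_def)
  let ?K = "attach q {u} ?H"
  have uq: "q \<notin> {u}" "finite {u}" "{u} \<inter> verts ?H \<noteq> {}" using u q' by (auto simp: attach_def)
  note k = attach_props[OF h(1,2) q uq]
  have deg: "degree ?K x = (if x = q \<or> x = p then 1 else if x = u then 3 else degree G x)" for x
    unfolding k(5) h(5) using u(2) q' p u(1) by auto
  have n: "graph_order ?K = n + 2" using k(3) h(3) u G(3) by (simp add: attach_def)
  have m: "graph_size ?K = m + 2" using k(4) h(4) G(4) by simp
  have K: "subcubic ?K"
    unfolding subcubic_def using k(1,2) n g(3,6) G(3) deg by (auto simp: attach_def)
  have sub: "edges G \<subseteq> edges ?K" by (auto simp: attach_def)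
  have new: "\<exists>y. e = {u, y} \<and> degree ?K y < 3" if "e \<in> edges ?K - edges G" for e
  proof -
    have "e = {u, p} \<or> e = {u, q}" using that by (auto simp: attach_def)
    moreover have "degree ?K p < 3" "degree ?K q < 3" using deg p q' u by auto
    ultimately show ?thesis by blast
  qed
  have cubic: "degree ?K x = 3 \<longleftrightarrow> degree G x = 3 \<or> x = u" if "x \<in> verts G" for x
    using deg that p q' u by auto
  note num_edges_if_leaf_becomes_cubic[OF G(1,2) u sub new cubic]
  moreover have "(m + 2) mod 3 = 2" using c(6) G(4) by presburger
  moreover have "5 * m \<le> 6 * n" using c(4) G(3,4) by (metis le_add1)
  ultimately have "extremal ?K" unfolding extremal_def n m by simp
  thus ?thesis unfolding extremal_exists_def using n m K by blast
qed

text \<open>This covers the one case out of reach of the previous lemma, in which the result has a single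
  leaf: of the only two leaves, one is linked to the other and receives a new leaf.\<close>
lemma extremal_exists_link_leaves:
  assumes "alternating_exists n m" "5 * m + 6 = 6 * n"
  shows "extremal_exists (n + 1) (m + 2)"
proof -
  obtain G :: "nat ugraph" where G: "subcubic G" "alternating G" "graph_order G = n" "graph_size G = m"
    using assms(1) by (auto simp: alternating_exists_def)
  note g = subcubicD[OF G(1)]
  note c = alternating_counts[OF G(1,2)]
  have "card {v \<in> verts G. degree G v = 1} = 2" using c(4) assms(2) G(3,4) by simp
  then obtain u u' where "{v \<in> verts G. degree G v = 1} = {u, u'}" "u \<noteq> u'"
    by (auto simp: card_2_iff)
  hence u: "u \<in> verts G" "degree G u = 1" and u': "u' \<in> verts G" "degree G u' = 1" "u \<noteq> u'"
    by blast+
  have "{u, u'} \<notin> edges G"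
  proof
    assume "{u, u'} \<in> edges G"
    hence "(degree G u = 3) \<noteq> (degree G u' = 3)" using G(2) by (simp add: alternating_def)
    thus False using u u' by simp
  qed
  note h = add_edge_props[OF g(1,2) u(1) u'(1,3) this]
  let ?H = "add_edge u u' G"
  obtain p where p: "p \<notin> verts ?H" using fresh_vertex[OF h(1)] .
  hence p': "p \<notin> verts G" "p \<noteq> u" "p \<noteq> u'" using u u' by (auto simp: add_edge_def)
  let ?K = "attach p {u} ?H"
  have up: "p \<notin> {u}" "finite {u}" "{u} \<inter> verts ?H \<noteq> {}" using u p' by (auto simp: add_edge_def)
  note k = attach_props[OF h(1,2) p up]
  have deg: "degree ?K x = (if x = p then 1 else if x = u then 3 else if x = u' then 2 else degree G x)" for x
    unfolding k(5) h(5) using u(2) u' p' by auto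
  have n: "graph_order ?K = n + 1" using k(3) h(3) u G(3) by (simp add: add_edge_def)
  have m: "graph_size ?K = m + 2" using k(4) h(4) G(4) by simp
  have K: "subcubic ?K"
    unfolding subcubic_def using k(1,2) n g(3,6) G(3) deg by (auto simp: attach_def add_edge_def)
  have sub: "edges G \<subseteq> edges ?K" by (auto simp: attach_def add_edge_def)
  have new: "\<exists>y. e = {u, y} \<and> degree ?K y < 3" if "e \<in> edges ?K - edges G" for e
  proof -
    have "e = {u, p} \<or> e = {u, u'}" using that by (auto simp: attach_def add_edge_def)
    moreover have "degree ?K p < 3" "degree ?K u' < 3" using deg p' u u' by auto
    ultimately show ?thesis by blast
  qed
  have cubic: "degree ?K x = 3 \<longleftrightarrow> degree G x = 3 \<or> x = u" if "x \<in> verts G" for x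
    using deg that p' u u' by auto
  note num_edges_if_leaf_becomes_cubic[OF G(1,2) u sub new cubic]
  moreover have "(m + 2) mod 3 = 2" using c(6) G(4) by presburger
  moreover have "5 * (m + 2) < 6 * (n + 1)" using assms(2) by simp
  ultimately have "extremal ?K" unfolding extremal_def n m by simp
  thus ?thesis unfolding extremal_exists_def using n m K by blast
qed

text \<open>These are the graphs with the optimal counts for \<open>6n \<le> 5m\<close>: all degrees are 2 or 3, and no two
  vertices of degree 2 are adjacent.\<close>
definition leafless_exists :: "nat \<Rightarrow> nat \<Rightarrow> bool" where
  "leafless_exists n m \<longleftrightarrow> (\<exists>G :: nat ugraph. subcubic G \<and> graph_order G = n \<and> graph_size G = m \<and>
     (\<forall>v\<in>verts G. degree G v \<noteq> 1) \<and>
     (\<forall>u v. {u, v} \<in> edges G \<longrightarrow> degree G u = 3 \<or> degree G v = 3))"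

lemma leafless_counts:
  assumes "subcubic G" "\<forall>v\<in>verts G. degree G v \<noteq> 1"
    and "\<And>u v. {u, v} \<in> edges G \<Longrightarrow> degree G u = 3 \<or> degree G v = 3"
  shows "num_edges 1 2 G = 0" "num_edges 1 3 G = 0" "num_edges 2 2 G = 0"
    and "num_edges 3 3 G + 6 * graph_order G = 5 * graph_size G"
    and "card {v \<in> verts G. degree G v = 2} + 2 * graph_size G = 3 * graph_order G"
proof -
  note g = subcubicD[OF assms(1)]
  show *: "num_edges 1 2 G = 0" "num_edges 1 3 G = 0" "num_edges 2 2 G = 0"
    using assms(2,3) edge_in_verts[OF g(1)] by (intro num_edges_eq_0; force)+
  show "num_edges 3 3 G + 6 * graph_order G = 5 * graph_size G"
    "card {v \<in> verts G. degree G v = 2} + 2 * graph_size G = 3 * graph_order G"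
    using subcubic_edge_count[OF assms(1)] * by linarith+
qed

lemma extremal_exists_if_leafless:
  assumes "leafless_exists n m"
  shows "extremal_exists n m"
proof -
  obtain G :: "nat ugraph" where G: "subcubic G" "graph_order G = n" "graph_size G = m"
    "\<forall>v\<in>verts G. degree G v \<noteq> 1"
    "\<And>u v. {u, v} \<in> edges G \<Longrightarrow> degree G u = 3 \<or> degree G v = 3"
    using assms unfolding leafless_exists_def by blast
  note c = leafless_counts[OF G(1,4,5)]
  have "extremal G" using c by (auto simp: extremal_def)
  thus ?thesis unfolding extremal_exists_def using G by blast
qed

text \<open>With these numbers of vertices and edges an alternating graph has no leaves left; it is the
  complete bipartite graph with parts of sizes 2 and 3.\<close>
lemma leafless_exists_theta: "leafless_exists 5 6"
proof -
  obtain G :: "nat ugraph" where G: "subcubic G" "alternating G" "graph_order G = 5" "graph_size G = 6"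
    using alternating_existsI[of 2 5] by (auto simp: alternating_exists_def)
  have "card {v \<in> verts G. degree G v = 1} = 0" using alternating_counts(4)[OF G(1,2)] G(3,4) by simp
  hence "\<forall>v\<in>verts G. degree G v \<noteq> 1" using subcubicD(4)[OF G(1)] by simp
  thus ?thesis unfolding leafless_exists_def using G unfolding alternating_def by blast
qed

lemma leafless_exists_subdivide:
  assumes "leafless_exists n m" "6 * n < 5 * m"
  shows "leafless_exists (n + 1) (m + 1)"
proof -
  obtain G :: "nat ugraph" where G: "subcubic G" "graph_order G = n" "graph_size G = m"
    "\<forall>v\<in>verts G. degree G v \<noteq> 1"
    "\<And>u v. {u, v} \<in> edges G \<Longrightarrow> degree G u = 3 \<or> degree G v = 3"
    using assms unfolding leafless_exists_def by blast
  note g = subcubicD[OF G(1)]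
  have "num_edges 3 3 G \<noteq> 0" using leafless_counts(4)[OF G(1,4,5)] assms(2) G(2,3) by simp
  hence "edges_of_type 3 3 G \<noteq> {}" by (auto simp: num_edges_eq_card)
  then obtain u v where uv: "{u, v} \<in> edges G" "degree G u = 3" "degree G v = 3"
    by (auto simp: edges_of_type_def)
  note uv' = edge_in_verts[OF g(1) uv(1)]
  obtain w where w: "w \<notin> verts G" using fresh_vertex[OF g(1)] .
  let ?G = "subdivide u v w G"
  note p = subdivide_props[OF g(1,2) uv(1) w]
  have "subcubic ?G"
    unfolding subcubic_def using p g(3,6) by (auto simp: subdivide_def)
  moreover have "\<forall>x\<in>verts ?G. degree ?G x \<noteq> 1"
    unfolding p(5) using G(4) by (auto simp: subdivide_def)
  moreover have "degree ?G x = 3 \<or> degree ?G y = 3" if "{x, y} \<in> edges ?G" for x y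
    unfolding p(5) using that G(5)[of x y] uv uv' w simple_graph_no_edge[OF g(1) w]
    by (auto simp: subdivide_def doubleton_eq_iff)
  ultimately show ?thesis
    unfolding leafless_exists_def using p(3,4) G(2,3) by (intro exI[of _ ?G]) simp
qed

text \<open>Two vertices of degree 2 are never adjacent here, so linking them does not double an edge. The
  second assumption says that there are two of them.\<close>
lemma leafless_exists_link:
  assumes "leafless_exists n m" "2 * m + 2 \<le> 3 * n"
  shows "leafless_exists n (m + 1)"
proof -
  obtain G :: "nat ugraph" where G: "subcubic G" "graph_order G = n" "graph_size G = m"
    "\<forall>v\<in>verts G. degree G v \<noteq> 1"
    "\<And>u v. {u, v} \<in> edges G \<Longrightarrow> degree G u = 3 \<or> degree G v = 3"
    using assms unfolding leafless_exists_def by blast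
  note g = subcubicD[OF G(1)]
  have "2 \<le> card {v \<in> verts G. degree G v = 2}"
    using leafless_counts(5)[OF G(1,4,5)] assms(2) G(2,3) by simp
  then obtain S where "S \<subseteq> {v \<in> verts G. degree G v = 2}" "card S = 2"
    by (meson obtain_subset_with_card_n)
  then obtain u v where uv: "u \<in> verts G" "v \<in> verts G" "u \<noteq> v" "degree G u = 2" "degree G v = 2"
    by (auto simp: card_2_iff)
  have "{u, v} \<notin> edges G" using G(5)[of u v] uv by auto
  note p = add_edge_props[OF g(1,2) uv(1-3) this]
  let ?G = "add_edge u v G"
  have "subcubic ?G"
    unfolding subcubic_def using p g(3,6) uv by (auto simp: add_edge_def)
  moreover have "\<forall>x\<in>verts ?G. degree ?G x \<noteq> 1"
    unfolding p(5) using G(4) uv by (auto simp: add_edge_def)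
  moreover have "degree ?G x = 3 \<or> degree ?G y = 3" if "{x, y} \<in> edges ?G" for x y
    unfolding p(5) using that G(5)[of x y] uv
    by (auto simp: add_edge_def doubleton_eq_iff)
  ultimately show ?thesis
    unfolding leafless_exists_def using p(3,4) G(2,3) by (intro exI[of _ ?G]) simp
qed

text \<open>Such a graph has \<open>2r\<close> vertices of degree 3 and \<open>n - 2r\<close> of degree 2. In the step, the graph with
  three vertices of degree 2 loses two of them by a link, which leaves one; subdivisions then raise
  the order up to \<open>5(r + 1)\<close>, where no edge of type 33 is left.\<close>
lemma leafless_existsI:
  assumes "1 \<le> r" "2 * r + 3 \<le> n" "n \<le> 5 * r"
  shows "leafless_exists n (n + r)"
  using assms
proof (induction r arbitrary: n rule: dec_induct)
  case base
  hence "n = 5" by simp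
  thus ?case using leafless_exists_theta by simp
next
  case (step r)
  have "leafless_exists (2 * r + 3) (2 * r + 3 + r)"
    by (rule step.IH) (use step.hyps in linarith)+
  hence start: "leafless_exists (2 * r + 3) (2 * r + 3 + Suc r)"
    using leafless_exists_link[of "2 * r + 3" "2 * r + 3 + r"] by simp
  have "2 * r + 3 \<le> n" using step.prems by simp
  thus ?case using step.prems(2)
  proof (induction n rule: dec_induct)
    case base
    show ?case by (rule start)
  next
    case (step n)
    thus ?case using leafless_exists_subdivide[of n "n + Suc r"] by simp
  qed
qed

lemma extremal_existsI:
  assumes "7 \<le> n" "n \<le> m + 1" "2 * m + 3 \<le> 3 * n"
  shows "extremal_exists n m"
proof (cases "6 * n \<le> 5 * m")
  case True
  hence "leafless_exists n (n + (m - n))"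
    using assms by (intro leafless_existsI) auto
  moreover have "n + (m - n) = m" using True by simp
  ultimately show ?thesis using extremal_exists_if_leafless by simp
next
  case False
  define k where "k = m div 3"
  have k: "2 \<le> k" using assms by (simp add: k_def)
  consider "m = 3 * k" | "m = 3 * k + 1" | "m = 3 * k + 2 \<and> 5 * k + 5 \<le> 2 * n"
    | "m = 3 * k + 2 \<and> 2 * n = 5 * k + 4"
    \<comment> \<open>For \<open>m = 3k + 2\<close>, the bound \<open>5m < 6n\<close> gives only \<open>15k + 11 \<le> 6n\<close>, but \<open>6n\<close> is divisible by 3.\<close>
  proof -
    have "m mod 3 = 0 \<or> m mod 3 = 1 \<or> m mod 3 = 2" by linarith
    moreover have "m = 3 * k + m mod 3" by (simp add: k_def)
    ultimately have "m = 3 * k \<or> m = 3 * k + 1 \<or> m = 3 * k + 2 \<and> 5 * k + 5 \<le> 2 * n \<or>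
      m = 3 * k + 2 \<and> 2 * n = 5 * k + 4"
      using False by linarith
    thus thesis using that by blast
  qed
  thus ?thesis
  proof cases
    case 1
    hence "alternating_exists n (3 * k)"
      using assms k False by (intro alternating_existsI) auto
    thus ?thesis using extremal_exists_if_alternating 1 by simp
  next
    case 2
    hence "alternating_exists (n - 1) (3 * k)"
      using assms k False by (intro alternating_existsI) auto
    thus ?thesis using extremal_exists_subdivide[of "n - 1" "3 * k"] 2 k assms by simp
  next
    case 3
    hence "alternating_exists (n - 2) (3 * k)"
      using assms k by (intro alternating_existsI) auto
    moreover have "n - 2 + 2 = n" using assms by simp
    ultimately show ?thesis using extremal_exists_leaf_to_claw[of "n - 2" "3 * k"] 3 by simp
  next
    case 4
    hence "alternating_exists (n - 1) (3 * k)"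
      using assms k by (intro alternating_existsI) auto
    moreover have "n - 1 + 1 = n" "5 * (3 * k) + 6 = 6 * (n - 1)" using assms 4 by auto
    ultimately show ?thesis using extremal_exists_link_leaves[of "n - 1" "3 * k"] 4 by simp
  qed
qed

section \<open>Relabelling the vertices\<close>

definition relabel :: "('a \<Rightarrow> 'b) \<Rightarrow> 'a ugraph \<Rightarrow> 'b ugraph" where
  "relabel f G = (f ` verts G, (`) f ` edges G)"

lemma relabel_props:
  assumes G: "simple_graph G" and f: "inj_on f (verts G)"
  shows "simple_graph (relabel f G)"
    and "connected_graph G \<Longrightarrow> connected_graph (relabel f G)"
    and "graph_order (relabel f G) = graph_order G"
    and "graph_size (relabel f G) = graph_size G"
    and "v \<in> verts G \<Longrightarrow> degree (relabel f G) (f v) = degree G v"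
    and "num_edges i j (relabel f G) = num_edges i j G"
proof -
  have sub: "edges G \<subseteq> Pow (verts G)" using G by (auto simp: simple_graph_def)
  have inj: "inj_on ((`) f) (edges G)"
    using inj_on_image_Pow[OF f] sub by (rule inj_on_subset)
  have "card (f ` e) = 2" if "e \<in> edges G" for e
    using that G f card_image[OF inj_on_subset[OF f, of e]] by (auto simp: simple_graph_def)
  thus "simple_graph (relabel f G)"
    using G by (auto simp: simple_graph_def relabel_def)
  show "graph_order (relabel f G) = graph_order G"
    using f by (simp add: relabel_def card_image)
  show "graph_size (relabel f G) = graph_size G"
    using inj by (simp add: relabel_def card_image)
  show deg: "degree (relabel f G) (f v) = degree G v" if v: "v \<in> verts G" for v
  proof -
    have "f v \<in> f ` e \<longleftrightarrow> v \<in> e" if "e \<in> edges G" for e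
      using inj_on_image_mem_iff[OF f v, of e] that sub by blast
    hence "{e \<in> edges (relabel f G). f v \<in> e} = (`) f ` {e \<in> edges G. v \<in> e}"
      by (auto simp: relabel_def)
    moreover have "inj_on ((`) f) {e \<in> edges G. v \<in> e}"
      using inj by (rule inj_on_subset) auto
    ultimately show ?thesis by (simp add: degree_def card_image)
  qed
  have "edges_of_type i j (relabel f G) = (`) f ` edges_of_type i j G"
  proof -
    have *: "f ` e \<in> edges_of_type i j (relabel f G) \<longleftrightarrow> e \<in> edges_of_type i j G" if "e \<in> edges G" for e
    proof -
      obtain u v where uv: "e = {u, v}" "u \<in> verts G" "v \<in> verts G"
        using edgeE[OF G \<open>e \<in> edges G\<close>] by blast
      have "f ` e \<in> edges (relabel f G)"
        using \<open>e \<in> edges G\<close> by (simp add: relabel_def)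
      hence "{f u, f v} \<in> edges (relabel f G)" by (simp add: uv(1))
      thus ?thesis
        using \<open>e \<in> edges G\<close> deg[OF uv(2)] deg[OF uv(3)]
        unfolding uv(1) image_insert image_empty doubleton_in_edges_of_type_iff by simp
    qed
    have "e \<in> (`) f ` edges G" if "e \<in> edges_of_type i j (relabel f G)" for e
      using that by (simp add: edges_of_type_def relabel_def)
    moreover have "e \<in> edges G" if "e \<in> edges_of_type i j G" for e
      using that by (simp add: edges_of_type_def)
    ultimately show ?thesis using * by blast
  qed
  moreover have "inj_on ((`) f) (edges_of_type i j G)"
    using inj by (rule inj_on_subset) (auto simp: edges_of_type_def)
  ultimately show "num_edges i j (relabel f G) = num_edges i j G"
    by (simp add: num_edges_eq_card card_image)
  assume con: "connected_graph G"
  let ?R = "{(x, y). {x, y} \<in> edges G}" and ?R' = "{(x, y). {x, y} \<in> edges (relabel f G)}"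
  have "(f u, f v) \<in> ?R'\<^sup>*" if "(u, v) \<in> ?R\<^sup>*" for u v
    using that
  proof (induction rule: rtrancl_induct)
    case (step y z)
    have "f ` {y, z} \<in> edges (relabel f G)"
      unfolding relabel_def snd_conv by (rule imageI) (use step(2) in simp)
    hence "(f y, f z) \<in> ?R'" by simp
    thus ?case using step(3) by (rule rtrancl_into_rtrancl[rotated])
  qed simp
  thus "connected_graph (relabel f G)"
    using con by (auto simp: connected_graph_def relabel_def)
qed

text \<open>A minimizer is compared with graphs on vertices of its own type, so the graph constructed on
  natural numbers is moved to the vertex set of \<open>G\<close>.\<close>
lemma exists_extremal_competitor:
  assumes "chemical_graph (G :: 'a ugraph)"
  obtains H :: "'a ugraph" where "chemical_graph H" "graph_order H = graph_order G"
    "graph_size H = graph_size G" "extremal H"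
proof -
  have G: "subcubic G" "7 \<le> graph_order G" "2 * graph_size G + 3 \<le> 3 * graph_order G"
    using assms by (auto simp: chemical_graph_iff_subcubic)
  note g = subcubicD[OF G(1)]
  have "extremal_exists (graph_order G) (graph_size G)"
    using extremal_existsI[OF G(2) connected_graph_order_le_Suc_size[OF g(1,2)] G(3)] .
  then obtain K :: "nat ugraph" where K: "subcubic K" "extremal K"
    "graph_order K = graph_order G" "graph_size K = graph_size G"
    by (auto simp: extremal_exists_def)
  note k = subcubicD[OF K(1)]
  obtain f where f: "bij_betw f (verts K) (verts G)"
    using finite_same_card_bij[OF k(4) g(4) K(3)] by blast
  note p = relabel_props[OF k(1) bij_betw_imp_inj_on[OF f]]
  show ?thesis
  proof (rule that[of "relabel f K"])
    have "subcubic (relabel f K)"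
      unfolding subcubic_def using p(1,2,3,5) k by (auto simp: relabel_def)
    thus "chemical_graph (relabel f K)"
      using p(3,4) K(3,4) G(2,3) by (simp add: chemical_graph_iff_subcubic)
    show "extremal (relabel f K)" using K(2) unfolding extremal_def p(3,4,6) .
  qed (use p(3,4) K(3,4) in auto)
qed

section \<open>The minimizers\<close>

text \<open>The fourth case of \<open>F10\<close> is the one with \<open>x\<^sub>1\<^sub>3 = 0\<close> among the graphs with \<open>m mod 3 = 1\<close>. The lower
  bound \<open>n - 1 \<le> m\<close> is connectedness, and the other conditions and entries follow from the two
  identities for order and size.\<close>
lemma F10_iff_extremal:
  assumes "chemical_graph G"
  shows "G \<in> F10 \<longleftrightarrow> extremal G"
proof -
  have G: "subcubic G" "2 * graph_size G + 3 \<le> 3 * graph_order G"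
    using assms by (auto simp: chemical_graph_iff_subcubic)
  define n m where nm: "n = graph_order G" "m = graph_size G"
  define a b c d e where x: "a = num_edges 1 2 G" "b = num_edges 1 3 G" "c = num_edges 2 2 G"
    "d = num_edges 2 3 G" "e = num_edges 3 3 G"
  note g = subcubic_edge_count(1,5)[OF G(1), folded nm x]
  have le: "n \<le> m + 1"
    using connected_graph_order_le_Suc_size subcubicD(1,2)[OF G(1)] unfolding nm by blast
  have D: "6 * n + e = 5 * m + 4 * a + 3 * b + c" using g by linarith
  \<comment> \<open>The definition of \<open>F10\<close>, cleared of denominators and negative terms.\<close>
  have E: "G \<in> F10 \<longleftrightarrow>
      (5 * m + 2 \<le> 6 * n \<and> m mod 3 = 0 \<and> a = 0 \<and> 5 * m + 3 * b = 6 * n \<and>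
         c = 0 \<and> 6 * n + 3 * d = 8 * m \<and> e = 0) \<or>
      (5 * m + 2 \<le> 6 * n \<and> m mod 3 = 1 \<and> a = 0 \<and> 5 * m + 3 * b + 1 = 6 * n \<and>
         c = 1 \<and> 6 * n + 3 * d + 2 = 8 * m \<and> e = 0) \<or>
      (5 * m + 2 \<le> 6 * n \<and> m mod 3 = 2 \<and> a = 0 \<and> 5 * m + 3 * b = 6 * n + 1 \<and>
         c = 0 \<and> 6 * n + 3 * d + 4 = 8 * m \<and> e = 1) \<or>
      (5 * m + 1 = 6 * n \<and> a = 0 \<and> b = 0 \<and> c = 1 \<and> d + 1 = m \<and> e = 0) \<or>
      (6 * n \<le> 5 * m \<and> a = 0 \<and> b = 0 \<and> c = 0 \<and> 4 * m + d = 6 * n \<and> 6 * n + e = 5 * m)"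
  proof -
    have le': "real n - 1 \<le> real m" using le by linarith
    have le3: "real m \<le> (3 * real n - 3) / 2"
      using assms unfolding chemical_graph_def nm by blast
    have rng: "real m \<le> (6 * real n - 2) / 5 \<longleftrightarrow> 5 * m + 2 \<le> 6 * n"
      "real m = (6 * real n - 1) / 5 \<longleftrightarrow> 5 * m + 1 = 6 * n"
      "6 * real n / 5 \<le> real m \<longleftrightarrow> 6 * n \<le> 5 * m"
      unfolding of_nat_le_iff[where 'a = real, symmetric] of_nat_eq_iff[where 'a = real, symmetric]
        of_nat_add of_nat_mult of_nat_numeral of_nat_1
      by (auto simp: field_simps)
    have val: "real b = (6 * real n - 5 * real m) / 3 \<longleftrightarrow> 5 * m + 3 * b = 6 * n"
      "real d = (8 * real m - 6 * real n) / 3 \<longleftrightarrow> 6 * n + 3 * d = 8 * m"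
      "real b = (6 * real n - 5 * real m - 1) / 3 \<longleftrightarrow> 5 * m + 3 * b + 1 = 6 * n"
      "real d = (8 * real m - 6 * real n - 2) / 3 \<longleftrightarrow> 6 * n + 3 * d + 2 = 8 * m"
      "real b = (6 * real n - 5 * real m + 1) / 3 \<longleftrightarrow> 5 * m + 3 * b = 6 * n + 1"
      "real d = (8 * real m - 6 * real n - 4) / 3 \<longleftrightarrow> 6 * n + 3 * d + 4 = 8 * m"
      "real d = real m - 1 \<longleftrightarrow> d + 1 = m"
      "real d = 6 * real n - 4 * real m \<longleftrightarrow> 4 * m + d = 6 * n"
      "real e = 5 * real m - 6 * real n \<longleftrightarrow> 6 * n + e = 5 * m"
      unfolding of_nat_le_iff[where 'a = real, symmetric] of_nat_eq_iff[where 'a = real, symmetric]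
        of_nat_add of_nat_mult of_nat_numeral of_nat_1
      by (auto simp: field_simps)
    show ?thesis
      using assms le' le3
      unfolding F10_def mem_Collect_eq Let_def edge_type_vector_def nm[symmetric] x[symmetric]
        prod.inject rng val
      by simp
  qed
  have X: "extremal G \<longleftrightarrow> a = 0 \<and> (if 5 * m < 6 * n
      then c = of_bool (m mod 3 = 1) \<and> e = of_bool (m mod 3 = 2) else b = 0 \<and> c = 0)"
    unfolding extremal_def nm x ..
  have mod: "(m + e) mod 3 = (a + c) mod 3" using size_mod_3[OF D] .
  show ?thesis
  proof (cases "5 * m < 6 * n")
    case False
    hence "\<not> 5 * m + 2 \<le> 6 * n" "5 * m + 1 \<noteq> 6 * n" "6 * n \<le> 5 * m" by linarith+
    moreover have "4 * m + d = 6 * n \<and> 6 * n + e = 5 * m" if "a = 0" "b = 0" "c = 0"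
      using D g(1) that by linarith
    ultimately show ?thesis unfolding E X using False by auto
  next
    case pos: True
    show ?thesis
    proof
      assume "extremal G"
      hence a: "a = 0" and c: "c = of_bool (m mod 3 = 1)" and e: "e = of_bool (m mod 3 = 2)"
        using pos unfolding X by auto
      consider "m mod 3 = 0" | "m mod 3 = 1" | "m mod 3 = 2" by linarith
      thus "G \<in> F10"
      proof cases
        case 1
        hence ce: "c = 0" "e = 0" using c e by auto
        hence *: "5 * m + 3 * b = 6 * n" "6 * n + 3 * d = 8 * m"
          using D g(1) a by linarith+
        have "1 \<le> b" using * pos by (cases b) auto
        hence "5 * m + 2 \<le> 6 * n" using * by linarith
        thus ?thesis unfolding E using 1 * ce a by blast
      next
        case 2
        hence ce: "c = 1" "e = 0" using c e by auto
        hence *: "5 * m + 3 * b + 1 = 6 * n" "6 * n + 3 * d + 2 = 8 * m"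
          using D g(1) a by linarith+
        show ?thesis
        proof (cases "b = 0")
          case True
          hence "5 * m + 1 = 6 * n" "d + 1 = m" using * ce a g(1) by linarith+
          thus ?thesis unfolding E using True ce a by blast
        next
          case False
          hence "5 * m + 2 \<le> 6 * n" using * by linarith
          thus ?thesis unfolding E using 2 * ce a by blast
        qed
      next
        case 3
        hence ce: "c = 0" "e = 1" using c e by auto
        hence *: "5 * m + 3 * b = 6 * n + 1" "6 * n + 3 * d + 4 = 8 * m"
          using D g(1) a by linarith+
        have "1 \<le> b" using * pos by (cases b) auto
        hence "5 * m + 2 \<le> 6 * n" using * by linarith
        thus ?thesis unfolding E using 3 * ce a by blast
      qed
    next
      assume "G \<in> F10"
      hence "a = 0 \<and> c = of_bool (m mod 3 = 1) \<and> e = of_bool (m mod 3 = 2)"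
        unfolding E using pos mod by auto
      thus "extremal G" unfolding X using pos by simp
    qed
  qed
qed

theorem theorem21:
  fixes G :: "'a ugraph"
  assumes "chemical_graph G"
  shows "minimizes aZagreb G \<longleftrightarrow> G \<in> F10"
proof -
  obtain H :: "'a ugraph" where H: "chemical_graph H" "graph_order H = graph_order G"
    "graph_size H = graph_size G" "extremal H"
    using exists_extremal_competitor[OF assms] .
  have sub: "subcubic K" if "chemical_graph K" for K :: "'a ugraph"
    using that by (simp add: chemical_graph_iff_subcubic)
  have "minimizes aZagreb G \<longleftrightarrow> extremal G"
  proof
    assume "minimizes aZagreb G"
    hence "aZagreb G \<le> aZagreb H" using H unfolding minimizes_def by blast
    thus "extremal G" using extremal_aZagreb_le(2)[OF sub[OF assms] sub[OF H(1)] H(2,3,4)] by simp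
  next
    assume "extremal G"
    thus "minimizes aZagreb G"
      unfolding minimizes_def using extremal_aZagreb_le(1)[OF sub sub[OF assms]] by simp
  qed
  thus ?thesis using F10_iff_extremal[OF assms] by simp
qed

end
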